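(* Let $n$ be a positive integer and let $k,l$ be integers with $1\le k$, $k+4\le l\le n$. Any $n\times n$ strictly upper triangular matrix of an $L_3(k,l)$-formation is CN-realizable.
   Context: $L_3(k,l)$-formation. A strictly upper triangular $n\times n$ matrix $M$ has an $L_3(k,l)$-formation if: - $M(k,j)=2$ when $j=k+1$ or $k+4\le j\le l$; - $M(k,k+2)$ is $0$ or $2$; - $M(k+1,k+4)$ is $0$ or $2$; - $M(k+2,j)=2$ when $k+4\le j\le l$; - $M(k+3,j)=2$ when $k+4\le j\le l$; - all other entries are $0$. Braid projections. An $n$-braid projection $B$ consists of $n$ strands in the plane, each running monotonically downward from one of $n$ points on an upper horizontal bar to one of $n$ points on a lower horizontal bar, meeting each other only in finitely many transverse double points (crossings), with no over/under information. The strands are named $s_1,\dots,s_n$ from left to right at the top. Combinatorially, $B$ is encoded by a finite word with letters in $\{1,\dots,n-1\}$: reading from top to bottom, the letter $k$ means that the two strands currently in positions $k$ and $k+1$ cross once and exchange positions (no reduction is assumed). The CN matrix $N(B)$ is the symmetric zero-diagonal $n\times n$ matrix whose $(i,j)$ entry ($i\neq j$) is the number of crossings between $s_i$ and $s_j$. CN matrices are represented by strictly upper triangular matrices: a strictly upper triangular $n\times n$ matrix $M$ is CN-realizable if there is an $n$-braid projection $B$ with $M(i,j)=N(B)(i,j)$ for all $1\le i<j\le n$. *)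

theory Defs
  imports "Jordan_Normal_Form.Matrix" "HOL-Combinatorics.Transposition"
begin

text \<open>Library matrices are indexed from \<open>0\<close>; \<open>entry M i j\<close> is the entry in row \<open>i\<close> and
  column \<open>j\<close> counted from \<open>1\<close>. It is only used with \<open>1 \<le> i\<close> and \<open>1 \<le> j\<close>.\<close>

definition entry :: "'a mat \<Rightarrow> nat \<Rightarrow> nat \<Rightarrow> 'a" where
  "entry M i j = M $$ (i - 1, j - 1)"

definition strictly_upper_triangular :: "nat \<Rightarrow> 'a::zero mat \<Rightarrow> bool" where
  "strictly_upper_triangular n M \<longleftrightarrow>
     M \<in> carrier_mat n n \<and> (\<forall>i\<in>{1..n}. \<forall>j\<in>{1..n}. j \<le> i \<longrightarrow> entry M i j = 0)"

text \<open>A braid projection on \<open>n\<close> strands is a word with letters in \<open>{1..n-1}\<close>; the head of the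
  list is the topmost crossing.\<close>

definition braid_projection :: "nat \<Rightarrow> nat list \<Rightarrow> bool" where
  "braid_projection n w \<longleftrightarrow> set w \<subseteq> {1..n - 1}"

text \<open>\<open>strand_at w p\<close> is the name of the strand in position \<open>p\<close> below all crossings of \<open>w\<close>.\<close>

definition strand_at :: "nat list \<Rightarrow> nat \<Rightarrow> nat" where
  "strand_at w = fold (\<lambda>k s. s \<circ> Transposition.transpose k (k + 1)) w id"

definition crossing_number :: "nat list \<Rightarrow> nat \<Rightarrow> nat \<Rightarrow> nat" where
  "crossing_number w i j =
     card {m \<in> {..<length w}.
       {strand_at (take m w) (w ! m), strand_at (take m w) (w ! m + 1)} = {i, j}}"

definition CN_matrix :: "nat \<Rightarrow> nat list \<Rightarrow> nat mat" where
  "CN_matrix n w =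
     mat n n (\<lambda>(i, j). if i = j then 0 else crossing_number w (i + 1) (j + 1))"

definition CN_realizable :: "nat \<Rightarrow> nat mat \<Rightarrow> bool" where
  "CN_realizable n M \<longleftrightarrow> strictly_upper_triangular n M \<and>
     (\<exists>w. braid_projection n w \<and>
       (\<forall>i j. 1 \<le> i \<and> i < j \<and> j \<le> n \<longrightarrow> entry M i j = entry (CN_matrix n w) i j))"

definition L3_formation :: "nat \<Rightarrow> nat \<Rightarrow> nat \<Rightarrow> nat mat \<Rightarrow> bool" where
  "L3_formation n k l M \<longleftrightarrow> strictly_upper_triangular n M \<and>
     (\<forall>j. j = k + 1 \<or> k + 4 \<le> j \<and> j \<le> l \<longrightarrow> entry M k j = 2) \<and>
     entry M k (k + 2) \<in> {0, 2} \<and>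
     entry M (k + 1) (k + 4) \<in> {0, 2} \<and>
     (\<forall>j. k + 4 \<le> j \<and> j \<le> l \<longrightarrow> entry M (k + 2) j = 2) \<and>
     (\<forall>j. k + 4 \<le> j \<and> j \<le> l \<longrightarrow> entry M (k + 3) j = 2) \<and>
     (\<forall>i\<in>{1..n}. \<forall>j\<in>{1..n}.
        (i, j) \<notin> {(k, k + 1), (k, k + 2), (k + 1, k + 4)} \<union> {k, k + 2, k + 3} \<times> {k + 4..l}
        \<longrightarrow> entry M i j = 0)"

end

theory Submission
  imports Defs
begin

text \<open>Write \<open>a, b, c, d\<close> for the strands \<open>k, \<dots>, k + 3\<close> and \<open>e\<^sub>1, \<dots>, e\<^sub>m\<close> for the
  strands \<open>k + 4, \<dots>, l\<close>. Cross \<open>a\<close> and \<open>b\<close>, which gives the order \<open>b a c d e\<^sub>1 \<dots> e\<^sub>m\<close>; here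
  \<open>a\<close> and \<open>c\<close> are neighbours and may cross twice. Then interchange the blocks \<open>a c d\<close> and
  \<open>e\<^sub>1 \<dots> e\<^sub>m\<close>, which gives \<open>b e\<^sub>1 \<dots> e\<^sub>m a c d\<close>; here \<open>b\<close> and \<open>e\<^sub>1\<close> are neighbours and may
  cross twice. Finally undo the interchange and the first crossing, so that each of their
  crossings is counted twice.\<close>

lemma strand_at_Nil [simp]: "strand_at [] = id"
  by (simp add: strand_at_def)

lemma strand_at_snoc [simp]:
  "strand_at (w @ [x]) = strand_at w \<circ> Transposition.transpose x (Suc x)"
  by (simp add: strand_at_def)

lemma strand_at_append [simp]: "strand_at (u @ v) = strand_at u \<circ> strand_at v"
proof (induction v rule: rev_induct)
  case (snoc x v)
  then show ?case
    by (simp add: comp_assoc flip: append_assoc)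
qed simp

lemma strand_at_Cons [simp]:
  "strand_at (x # w) = Transposition.transpose x (Suc x) \<circ> strand_at w"
  using strand_at_append [of "[x]" w] strand_at_snoc [of "[]" x] by simp

lemma bij_strand_at: "bij (strand_at w)"
proof (induction w)
  case (Cons x w)
  then show ?case
    unfolding strand_at_Cons by (intro bij_comp bij_transpose)
qed (simp only: strand_at_Nil bij_id)

text \<open>Each letter acts as an involution, so equal letters cancel from the middle of
  \<open>u @ rev u\<close> outwards.\<close>

lemma strand_at_append_rev: "strand_at u \<circ> strand_at (rev u) = id"
proof (induction u)
  case (Cons x u)
  have "strand_at (x # u) \<circ> strand_at (rev (x # u)) = Transposition.transpose x (Suc x)
    \<circ> (strand_at u \<circ> strand_at (rev u)) \<circ> Transposition.transpose x (Suc x)"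
    by (simp add: comp_assoc)
  then show ?case
    unfolding Cons.IH comp_id transpose_comp_involutory .
qed simp

lemma crossing_number_Nil [simp]: "crossing_number [] i j = 0"
  by (simp add: crossing_number_def)

lemma crossing_number_snoc:
  "crossing_number (w @ [x]) i j =
     crossing_number w i j + of_bool ({strand_at w x, strand_at w (Suc x)} = {i, j})"
proof -
  define P where "P u m \<longleftrightarrow>
    {strand_at (take m u) (u ! m), strand_at (take m u) (u ! m + 1)} = {i, j}" for u m
  have cn: "crossing_number u i j = (\<Sum>m<length u. of_bool (P u m))" for u
    by (simp add: crossing_number_def P_def Int_def)
  have "P (w @ [x]) m = P w m" if "m < length w" for m
    using that by (simp add: P_def nth_append)
  then show ?thesis
    unfolding cn by (simp add: P_def nth_append)
qed

text \<open>Taken alone, \<open>v\<close> names strands by their positions below \<open>u\<close>;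
  the bijection \<open>strand_at u\<close> translates these names into those at the top.\<close>

lemma crossing_number_append:
  "crossing_number (u @ v) (strand_at u p) (strand_at u q) =
     crossing_number u (strand_at u p) (strand_at u q) + crossing_number v p q"
proof (induction v rule: rev_induct)
  case (snoc x v)
  have "{strand_at u y, strand_at u z} = {strand_at u p, strand_at u q} \<longleftrightarrow> {y, z} = {p, q}"
    for y z
    using inj_image_eq_iff [OF bij_is_inj [OF bij_strand_at], of u "{y, z}" "{p, q}"] by simp
  with snoc show ?case
    by (simp add: crossing_number_snoc flip: append_assoc)
qed simp

lemma crossing_number_single:
  "crossing_number [x] i j = of_bool ({i, j} = {x, Suc x})"
  using crossing_number_snoc [of "[]" x i j] by (auto simp: eq_commute)

text \<open>Turning a projection upside down keeps its crossings but names each strand by its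
  position at the other end.\<close>

lemma crossing_number_rev:
  "crossing_number (rev u) p q = crossing_number u (strand_at u p) (strand_at u q)"
proof (induction u arbitrary: p q)
  case (Cons x u)
  let ?t = "Transposition.transpose x (Suc x)"
  have "strand_at (rev u) (strand_at u y) = y" for y
    using fun_cong [OF strand_at_append_rev [of "rev u"], of y] by simp
  then have *: "crossing_number (rev u @ [x]) p q = crossing_number (rev u) p q
      + crossing_number [x] (strand_at u p) (strand_at u q)"
    using crossing_number_append [of "rev u" "[x]" "strand_at u p" "strand_at u q"] by simp
  \<comment> \<open>The letter \<open>x\<close> crosses the same two strands whether they are named
    above or below the crossing.\<close>
  have "{?t y, ?t z} = {x, Suc x} \<longleftrightarrow> {y, z} = {x, Suc x}" for y z
    by (auto simp: transpose_def doubleton_eq_iff split: if_splits)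
  then show ?case
    using * crossing_number_append [of "[x]" u "strand_at u p" "strand_at u q"] Cons.IH [of p q]
    by (simp add: crossing_number_single)
qed simp

text \<open>As \<open>v\<close> restores the order left by \<open>u\<close>, the final
  \<open>rev u\<close> repeats exactly the crossings of \<open>u\<close>; hence the factor
  2.\<close>

lemma crossing_number_conjugate:
  assumes "strand_at v = id"
  shows "crossing_number (u @ v @ rev u) (strand_at u p) (strand_at u q) =
    2 * crossing_number u (strand_at u p) (strand_at u q) + crossing_number v p q"
  using crossing_number_append [of u "v @ rev u" p q] crossing_number_append [of v "rev u" p q]
  by (simp add: assms crossing_number_rev)

text \<open>The flag lets one word cover both values, 0 and 2, of an optional entry.\<close>

definition double_crossing :: "bool \<Rightarrow> nat \<Rightarrow> nat list" where
  "double_crossing b x = (if b then [x, x] else [])"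

lemma strand_at_double_crossing [simp]: "strand_at (double_crossing b x) = id"
  by (simp add: double_crossing_def)

lemma crossing_number_double_crossing:
  "crossing_number (double_crossing b x) i j = 2 * of_bool (b \<and> {i, j} = {x, Suc x})"
  using crossing_number_snoc [of "[x]" x i j]
  by (auto simp: double_crossing_def crossing_number_single insert_commute)

text \<open>Before round \<open>t\<close> the strands that began at \<open>a\<close>,
  \<open>a + 1\<close>, \<open>a + 2\<close> occupy the positions from \<open>a + t\<close> on; the
  round carries their right neighbour past all three.\<close>

definition block_swap :: "nat \<Rightarrow> nat \<Rightarrow> nat list" where
  "block_swap a m = concat (map (\<lambda>t. [a + t + 2, a + t + 1, a + t]) [0..<m])"

lemma block_swap_0 [simp]: "block_swap a 0 = []"
  by (simp add: block_swap_def)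

lemma block_swap_Suc:
  "block_swap a (Suc m) = ((block_swap a m @ [a + m + 2]) @ [a + m + 1]) @ [a + m]"
  by (simp add: block_swap_def)

lemma strand_at_block_swap:
  "strand_at (block_swap a m) p =
     (if a \<le> p \<and> p < a + m then p + 3 else if a + m \<le> p \<and> p < a + m + 3 then p - m else p)"
proof (induction m arbitrary: p)
  case (Suc m)
  show ?case
    unfolding block_swap_Suc strand_at_snoc comp_apply Suc.IH transpose_def by simp
qed simp

lemma crossing_number_block_swap:
  "crossing_number (block_swap a m) i j =
     of_bool (i \<in> {a..<a + 3} \<and> j \<in> {a + 3..<a + 3 + m} \<or>
              j \<in> {a..<a + 3} \<and> i \<in> {a + 3..<a + 3 + m})"
proof (induction m)
  case (Suc m)
  \<comment> \<open>Strand \<open>a + m + 3\<close> has not moved yet and stands just right of the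
    triple, so the last round adds its three crossings with the triple and no others.\<close>
  have x: "strand_at (block_swap a m) (a + m + 3) = a + m + 3"
    "strand_at (block_swap a m) (a + m + 2) = a + 2"
    "strand_at (block_swap a m) (a + m + 1) = a + 1"
    "strand_at (block_swap a m) (a + m) = a"
    by (simp_all add: strand_at_block_swap)
  have "crossing_number (block_swap a (Suc m)) i j = crossing_number (block_swap a m) i j
      + of_bool ({a + 2, a + m + 3} = {i, j}) + of_bool ({a + 1, a + m + 3} = {i, j})
      + of_bool ({a, a + m + 3} = {i, j})"
    using x unfolding block_swap_Suc crossing_number_snoc strand_at_snoc comp_apply
    by (simp add: transpose_def eval_nat_numeral)
  moreover have "i \<in> {a + 3..<a + 3 + Suc m} \<longleftrightarrow> i \<in> {a + 3..<a + 3 + m} \<or> i = a + m + 3"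
    "i \<in> {a..<a + 3} \<longleftrightarrow> i = a \<or> i = a + 1 \<or> i = a + 2" for i
    by auto
  ultimately show ?case
    unfolding Suc.IH
    by (cases "i = a + m + 3"; cases "j = a + m + 3") (auto simp: doubleton_eq_iff)
qed simp

theorem proposition20:
  fixes n k l :: nat and M :: "nat mat"
  assumes "0 < n" and "1 \<le> k" and "k + 4 \<le> l" and "l \<le> n"
    and "strictly_upper_triangular n M"
    and "L3_formation n k l M"
  shows "CN_realizable n M"
proof -
  define ac where "ac \<longleftrightarrow> entry M k (k + 2) = 2"
  define be where "be \<longleftrightarrow> entry M (k + 1) (k + 4) = 2"
  \<comment> \<open>Names in \<open>X\<close> and \<open>v\<close> are positions below the first
    crossing: \<open>b\<close> is \<open>k\<close>, \<open>a\<close> is \<open>k + 1\<close>, and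
    the triple to be moved starts there. There are \<open>l - k - 3\<close> strands to its
    right.\<close>
  define X where "X = block_swap (k + 1) (l - k - 3)"
  define v where "v = double_crossing ac (k + 1) @ X @ double_crossing be k @ rev X"
  define w where "w = [k] @ v @ rev [k]"
  \<comment> \<open>\<open>?t\<close> translates between the original names and those used in
    \<open>v\<close>.\<close>
  let ?t = "Transposition.transpose k (Suc k)"
  have M: "entry M i j = 2 * of_bool (i = k \<and> j = k + 1 \<or> ac \<and> i = k \<and> j = k + 2
      \<or> be \<and> i = k + 1 \<and> j = k + 4 \<or> i \<in> {k, k + 2, k + 3} \<and> j \<in> {k + 4..l})"
    if "1 \<le> i" "i < j" "j \<le> n" for i j
  proof -
    let ?S = "{k, k + 2, k + 3} \<times> {k + 4..l}"
    have L: "entry M k (k + 1) = 2" "ac \<or> entry M k (k + 2) = 0"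
      "be \<or> entry M (k + 1) (k + 4) = 0" "(i, j) \<in> ?S \<Longrightarrow> entry M i j = 2"
      using \<open>L3_formation n k l M\<close> unfolding L3_formation_def ac_def be_def by auto
    have L0: "entry M i j = 0"
      if "(i, j) \<notin> {(k, k + 1), (k, k + 2), (k + 1, k + 4)} \<union> ?S"
      using \<open>L3_formation n k l M\<close> \<open>1 \<le> i\<close> \<open>i < j\<close> \<open>j \<le> n\<close> that
      unfolding L3_formation_def by simp
    consider "(i, j) \<in> ?S" | "i = k" "j = k + 1" | "i = k" "j = k + 2"
      | "i = k + 1" "j = k + 4"
      | "(i, j) \<notin> {(k, k + 1), (k, k + 2), (k + 1, k + 4)} \<union> ?S"
      by blast
    then show ?thesis
    proof cases
      case 1
      with L(4) show ?thesis by simp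
    next
      case 2
      with L(1) show ?thesis by simp
    next
      case 3
      with L(2) show ?thesis by (cases ac) (simp_all add: ac_def)
    next
      case 4
      with L(3) show ?thesis by (cases be) (simp_all add: be_def)
    next
      case 5
      with L0 show ?thesis by auto
    qed
  qed
  have v_id: "strand_at v = id"
    by (simp add: v_def strand_at_append_rev)
  have cX: "crossing_number (X @ double_crossing be k @ rev X) i j = 2 * crossing_number X i j
      + 2 * of_bool (be \<and> {i, j} = {k, k + 4})" for i j
  proof -
    obtain p q where pq: "strand_at X p = i" "strand_at X q = j"
      using bij_strand_at [of X] by (metis bij_pointE)
    \<comment> \<open>Since \<open>k + 4 \<le> l\<close>, at least one strand passes the triple, so
      the first of them ends up beside \<open>b\<close>.\<close>
    have "inj (strand_at X)" "strand_at X k = k" "strand_at X (Suc k) = k + 4"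
      using \<open>k + 4 \<le> l\<close> by (auto simp: X_def strand_at_block_swap bij_strand_at bij_is_inj)
    then have "{p, q} = {k, Suc k} \<longleftrightarrow> {i, j} = {k, k + 4}"
      using inj_image_eq_iff [of "strand_at X" "{p, q}" "{k, Suc k}"] pq by simp
    then show ?thesis
      using crossing_number_conjugate [of "double_crossing be k" X p q] pq
      by (simp add: crossing_number_double_crossing)
  qed
  have cv: "crossing_number v i j = 2 * of_bool (ac \<and> {i, j} = {k + 1, k + 2})
      + 2 * crossing_number X i j + 2 * of_bool (be \<and> {i, j} = {k, k + 4})" for i j
    using crossing_number_append [of "double_crossing ac (k + 1)" _ i j] cX [of i j]
    by (simp add: v_def crossing_number_double_crossing)
  have cw: "crossing_number w i j = 2 * of_bool ({i, j} = {k, Suc k})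
      + crossing_number v (?t i) (?t j)" for i j
    using crossing_number_conjugate [OF v_id, of "[k]" "?t i" "?t j"]
    by (simp add: w_def crossing_number_single)
  have "entry M i j = crossing_number w i j" if "1 \<le> i" "i < j" "j \<le> n" for i j
  proof -
    have E: "{k + 1 + 3..<k + 1 + 3 + (l - k - 3)} = {k + 4..l}"
      using \<open>k + 4 \<le> l\<close> by auto
    note c = M [OF that] cw cv X_def crossing_number_block_swap E
    \<comment> \<open>The cases fix \<open>?t i\<close> and \<open>?t j\<close>, since
      \<open>?t\<close> moves only \<open>k\<close> and \<open>k + 1\<close>.\<close>
    consider "i = k" "j = k + 1" | "i = k" "k + 1 < j" | "i = k + 1" | "j = k" | "j = k + 1" "i < k"
      | "i \<noteq> k" "i \<noteq> k + 1" "j \<noteq> k" "j \<noteq> k + 1"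
      using \<open>i < j\<close> by linarith
    then show ?thesis
    proof cases
      case 1
      then have t: "?t i = Suc k" "?t j = k"
        using \<open>i < j\<close> by (simp_all add: transpose_def)
      show ?thesis
        using 1 \<open>i < j\<close> unfolding c t by (simp add: doubleton_eq_iff)
    next
      case 2
      then have t: "?t i = Suc k" "?t j = j"
        using \<open>i < j\<close> by (simp_all add: transpose_def)
      show ?thesis
        using 2 \<open>i < j\<close> unfolding c t by (simp add: doubleton_eq_iff)
    next
      case 3
      then have t: "?t i = k" "?t j = j"
        using \<open>i < j\<close> by (simp_all add: transpose_def)
      show ?thesis
        using 3 \<open>i < j\<close> unfolding c t by (simp add: doubleton_eq_iff)
    next
      case 4
      then have t: "?t i = i" "?t j = Suc k"
        using \<open>i < j\<close> by (simp_all add: transpose_def)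
      show ?thesis
        using 4 \<open>i < j\<close> unfolding c t by (simp add: doubleton_eq_iff)
    next
      case 5
      then have t: "?t i = i" "?t j = k"
        using \<open>i < j\<close> by (simp_all add: transpose_def)
      show ?thesis
        using 5 \<open>i < j\<close> unfolding c t by (simp add: doubleton_eq_iff)
    next
      case 6
      then have t: "?t i = i" "?t j = j"
        using \<open>i < j\<close> by (simp_all add: transpose_def)
      show ?thesis
        using 6 \<open>i < j\<close> unfolding c t by (simp add: doubleton_eq_iff)
    qed
  qed
  \<comment> \<open>The largest letter is \<open>l - 1\<close>, from the last round of
    \<open>X\<close>; the smallest is \<open>k\<close>.\<close>
  moreover have "braid_projection n w"
    using assms(2-4)
    by (auto simp: braid_projection_def w_def v_def X_def block_swap_def double_crossing_def)
  ultimately show ?thesis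
    using \<open>strictly_upper_triangular n M\<close> unfolding CN_realizable_def
    by (auto simp: CN_matrix_def entry_def intro!: exI [of _ w])
qed

end
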